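(* Let $M\in\mathcal{LC}$ and let $r\ge1$ be an integer. Assume that the sequence of integers $(a_j)_{j\ge1}$ is a sequence of Lusky numbers for $M$. Then $(ra_j)_{j\ge1}$ is a sequence of Lusky numbers for the $r$-interpolating sequence $P^{M,r}$.
   Context: $\mathbb{N}=\{0,1,2,\dots\}$. For a sequence $M=(M_p)_{p\in\mathbb{N}}$ of positive reals put $\mu_p:=M_p/M_{p-1}$ for $p\ge1$ and $\mu_0:=1$. $\mathcal{LC}$ is the set of all such $M$ with $M_0=1\le M_1$, $M_p^2\le M_{p-1}M_{p+1}$ for all $p\ge1$, and $\lim_{p\to\infty}(M_p)^{1/p}=+\infty$. For integers $0\le k<l$, $$A_M(k,l):=\frac{(\mu_{l+1})^{l-k}}{\mu_{k+1}\cdots\mu_l},\qquad B_M(k,l):=\frac{\mu_{k+1}\cdots\mu_l}{(\mu_{k+1})^{l-k}}.$$ A strictly increasing sequence of nonnegative integers $(a_j)_{j\ge1}$ is called a sequence of Lusky numbers for $M$ if there exist constants $K\ge b>2$ such that for all $j\ge1$: $b\le\min\{A_M(a_j,a_{j+1}),B_M(a_j,a_{j+1})\}\le\max\{A_M(a_j,a_{j+1}),B_M(a_j,a_{j+1})\}\le K$. For $M\in\mathcal{LC}$ and an integer $r\ge1$, the $r$-interpolating sequence $P^{M,r}=(P^{M,r}_p)_{p\in\mathbb{N}}$ is defined by $$P^{M,r}_{rk+j}:=\big((M_k)^{r-j}(M_{k+1})^j\big)^{1/r},\qquad k\in\mathbb{N},\ j\in\{0,\dots,r\}$$ (it again belongs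 to $\mathcal{LC}$). *)

theory Defs
  imports "HOL-Analysis.Analysis"
begin

definition quot :: "(nat \<Rightarrow> real) \<Rightarrow> nat \<Rightarrow> real" where
  "quot M p = (if p = 0 then 1 else M p / M (p - 1))"

definition LC :: "(nat \<Rightarrow> real) set" where
  "LC = {M. (\<forall>p. M p > 0) \<and> M 0 = 1 \<and> 1 \<le> M 1
          \<and> (\<forall>p\<ge>1. (M p)\<^sup>2 \<le> M (p - 1) * M (p + 1))
          \<and> filterlim (\<lambda>p. root p (M p)) at_top sequentially}"

text \<open>The two quotients below are only meaningful for \<open>k < l\<close>; then the truncated subtraction
  \<open>l - k\<close> is the ordinary one.\<close>

definition lusky_A :: "(nat \<Rightarrow> real) \<Rightarrow> nat \<Rightarrow> nat \<Rightarrow> real" where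
  "lusky_A M k l = quot M (l + 1) ^ (l - k) / (\<Prod>i=k+1..l. quot M i)"

definition lusky_B :: "(nat \<Rightarrow> real) \<Rightarrow> nat \<Rightarrow> nat \<Rightarrow> real" where
  "lusky_B M k l = (\<Prod>i=k+1..l. quot M i) / quot M (k + 1) ^ (l - k)"

text \<open>The sequence \<open>(a\<^sub>j)\<close> is indexed by \<open>j \<ge> 1\<close>; the value \<open>a 0\<close> is irrelevant.\<close>

definition lusky_numbers :: "(nat \<Rightarrow> real) \<Rightarrow> (nat \<Rightarrow> nat) \<Rightarrow> bool" where
  "lusky_numbers M a \<longleftrightarrow>
     strict_mono_on {1..} a \<and>
     (\<exists>K b :: real. K \<ge> b \<and> b > 2 \<and>
       (\<forall>j\<ge>1.
          b \<le> min (lusky_A M (a j) (a (j + 1))) (lusky_B M (a j) (a (j + 1))) \<and>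
          min (lusky_A M (a j) (a (j + 1))) (lusky_B M (a j) (a (j + 1)))
            \<le> max (lusky_A M (a j) (a (j + 1))) (lusky_B M (a j) (a (j + 1))) \<and>
          max (lusky_A M (a j) (a (j + 1))) (lusky_B M (a j) (a (j + 1))) \<le> K))"

text \<open>For \<open>r \<ge> 1\<close>, an index \<open>p\<close> is written as \<open>p = r k + j\<close> with \<open>k = p div r\<close> and
  \<open>j = p mod r < r\<close>. The lemma after the definition shows that the defining formula also holds for
  the other admissible representation of a multiple of \<open>r\<close>, the one with \<open>j = r\<close>.\<close>

definition interp :: "(nat \<Rightarrow> real) \<Rightarrow> nat \<Rightarrow> nat \<Rightarrow> real" where
  "interp M r p =
     root r (M (p div r) ^ (r - p mod r) * M (p div r + 1) ^ (p mod r))"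

lemma interp_eq:
  assumes "r \<ge> 1" and "j \<le> r"
  shows "interp M r (r * k + j) = root r (M k ^ (r - j) * M (k + 1) ^ j)"
proof (cases "j = r")
  case True
  have "(r * k + r) div r = k + 1" "(r * k + r) mod r = 0"
    using assms(1) by auto
  then show ?thesis
    using True by (simp add: interp_def)
next
  case False
  then have "(r * k + j) div r = k" "(r * k + j) mod r = j"
    using assms(2) by auto
  then show ?thesis
    by (simp add: interp_def)
qed

end

theory Submission
  imports Defs
begin

text \<open>On a logarithmic scale the \<open>r\<close>-interpolating sequence \<open>P\<close> of \<open>M\<close> is the piecewise linear
  interpolation of the values of \<open>M\<close>, placed at the multiples of \<open>r\<close>. Two consequences carry the
  proof. First, \<open>P\<close> takes the value \<open>M k\<close> at \<open>r k\<close> (\<open>interp_mult\<close>), and a product of consecutive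
  quotients telescopes (\<open>prod_quot\<close>), so the product of the quotients of \<open>P\<close> from \<open>r k + 1\<close> to
  \<open>r l\<close> is the product of the quotients of \<open>M\<close> from \<open>k + 1\<close> to \<open>l\<close>. Second, the quotient of \<open>P\<close> at
  \<open>r k + 1\<close> is the \<open>r\<close>-th root of the quotient of \<open>M\<close> at \<open>k + 1\<close> (\<open>quot_interp\<close>); the exponent
  \<open>r l - r k = r (l - k)\<close> cancels this root. Hence
  \<open>A\<close> and \<open>B\<close> have the same values for \<open>P\<close> at \<open>(r k, r l)\<close> as for \<open>M\<close> at \<open>(k, l)\<close>, and the constants
  \<open>b\<close> and \<open>K\<close> that work for \<open>(a\<^sub>j)\<close> also work for \<open>(r a\<^sub>j)\<close>.\<close>

lemma prod_quot:
  assumes "\<And>p. M p > 0" and "k \<le> l"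
  shows "(\<Prod>i=k+1..l. quot M i) = M l / M k"
  using assms(2)
proof (induction l rule: dec_induct)
  case base
  then show ?case using assms(1)[of k] by simp
next
  case (step n)
  then show ?case
    using assms(1)[of n] by (simp add: quot_def)
qed

lemma interp_pos:
  assumes "\<And>p. M p > 0" and "r \<ge> 1"
  shows "interp M r p > 0"
  using assms by (simp add: interp_def)

lemma interp_mult:
  assumes "\<And>p. M p > 0" and "r \<ge> 1"
  shows "interp M r (r * k) = M k"
  using assms interp_eq[of r 0 M k] by (simp add: real_root_power_cancel less_imp_le)

lemma quot_interp:
  assumes "\<And>p. M p > 0" and "r \<ge> 1"
  shows "quot (interp M r) (r * k + 1) = root r (quot M (k + 1))"
proof -
  have "interp M r (r * k + 1) = root r (M k ^ (r - 1) * M (k + 1))"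
    using interp_eq[of r 1 M k] assms(2) by simp
  moreover have "M k = root r (M k ^ r)"
    using assms by (simp add: real_root_power_cancel less_imp_le)
  ultimately have "quot (interp M r) (r * k + 1)
      = root r (M k ^ (r - 1) * M (k + 1) / M k ^ r)"
    using interp_mult[of M r k] assms by (simp add: quot_def real_root_divide)
  also have "M k ^ (r - 1) * M (k + 1) / M k ^ r = quot M (k + 1)"
    using assms(1)[of k] power_minus_mult[of r "M k"] assms(2)
    by (simp add: quot_def field_simps)
  finally show ?thesis .
qed

lemma quot_interp_power:
  assumes "\<And>p. M p > 0" and "r \<ge> 1"
  shows "quot (interp M r) (r * m + 1) ^ (r * l - r * k) = quot M (m + 1) ^ (l - k)"
proof -
  have "quot M (m + 1) \<ge> 0"
    using assms(1) by (simp add: quot_def less_imp_le)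
  then have "root r (quot M (m + 1)) ^ r = quot M (m + 1)"
    using assms(2) by simp
  then show ?thesis
    unfolding quot_interp[OF assms] by (simp add: diff_mult_distrib2[symmetric] power_mult)
qed

lemma prod_quot_interp:
  assumes "\<And>p. M p > 0" and "r \<ge> 1" and "k \<le> l"
  shows "(\<Prod>i=r*k+1..r*l. quot (interp M r) i) = (\<Prod>i=k+1..l. quot M i)"
  using prod_quot[of "interp M r" "r * k" "r * l"] prod_quot[of M k l]
    interp_pos[of M r] interp_mult[of M r] assms by simp

lemma lusky_A_interp:
  assumes "\<And>p. M p > 0" and "r \<ge> 1" and "k \<le> l"
  shows "lusky_A (interp M r) (r * k) (r * l) = lusky_A M k l"
  unfolding lusky_A_def quot_interp_power[OF assms(1,2)] prod_quot_interp[OF assms] ..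

lemma lusky_B_interp:
  assumes "\<And>p. M p > 0" and "r \<ge> 1" and "k \<le> l"
  shows "lusky_B (interp M r) (r * k) (r * l) = lusky_B M k l"
  unfolding lusky_B_def quot_interp_power[OF assms(1,2)] prod_quot_interp[OF assms] ..

theorem lemma4p9:
  fixes M :: "nat \<Rightarrow> real" and r :: nat and a :: "nat \<Rightarrow> nat"
  assumes "M \<in> LC"
    and "r \<ge> 1"
    and "lusky_numbers M a"
  shows "lusky_numbers (interp M r) (\<lambda>j. r * a j)"
proof -
  have pos: "M p > 0" for p
    using assms(1) by (simp add: LC_def)
  have mono: "strict_mono_on {1..} a"
    using assms(3) by (simp add: lusky_numbers_def)
  then have "strict_mono_on {1..} (\<lambda>j. r * a j)"
    using assms(2) by (simp add: strict_mono_on_def)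
  moreover have le: "a j \<le> a (j + 1)" if "j \<ge> 1" for j
    using strict_mono_onD[OF mono, of j "j + 1"] that by simp
  have "lusky_A (interp M r) (r * a j) (r * a (j + 1)) = lusky_A M (a j) (a (j + 1))"
    and "lusky_B (interp M r) (r * a j) (r * a (j + 1)) = lusky_B M (a j) (a (j + 1))"
    if "j \<ge> 1" for j
    using lusky_A_interp[OF pos assms(2) le[OF that]] lusky_B_interp[OF pos assms(2) le[OF that]]
    by simp_all
  ultimately show ?thesis
    using assms(3) unfolding lusky_numbers_def by simp
qed

end
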